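(* For any connected graph $G$ (with at least two vertices) and for any real number $k\in[1,\kappa(G)]$, $\dim_f^k(G)\ge k\dim_f(G)$.
   Context: All graphs are finite, simple and undirected. $d(x,y)$ is the length of a shortest path between $x$ and $y$ in $G$. For distinct $x,y\in V(G)$, let $R\{x,y\}=\{z\in V(G): d(x,z)\neq d(y,z)\}$, and let $\kappa(G)=\min\{|R\{x,y\}|: x\neq y,\ x,y\in V(G)\}$. For a function $g$ on $V(G)$ and $U\subseteq V(G)$, write $g(U)=\sum_{s\in U}g(s)$. For a real number $k\in[1,\kappa(G)]$, a function $g:V(G)\to[0,1]$ is a $k$-resolving function of $G$ if $g(R\{x,y\})\ge k$ for any two distinct vertices $x,y\in V(G)$; the fractional $k$-metric dimension is $\dim_f^k(G)=\min\{g(V(G)): g \text{ is a } k\text{-resolving function of } G\}$. The fractional metric dimension is $\dim_f(G)=\dim_f^1(G)$. *)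

theory Defs
  imports Complex_Main "Graph_Theory.Graph_Theory"
begin

text \<open>
  A finite simple undirected graph is an instance of the locale \<^locale>\<open>graph\<close>: a finite symmetric
  digraph without loops or parallel arcs, each undirected edge being the pair of its two orientations.
\<close>

text \<open>With unit weights, the library's minimal walk cost is the length of a shortest path.\<close>

definition graph_dist :: "('a, 'b) pre_digraph \<Rightarrow> 'a \<Rightarrow> 'a \<Rightarrow> ereal" where
  "graph_dist G x y = wf_digraph.\<mu> G (\<lambda>_. 1) x y"

definition resolving_nbhd :: "('a, 'b) pre_digraph \<Rightarrow> 'a \<Rightarrow> 'a \<Rightarrow> 'a set" where
  "resolving_nbhd G x y = {z \<in> verts G. graph_dist G x z \<noteq> graph_dist G y z}"

definition kappa :: "('a, 'b) pre_digraph \<Rightarrow> nat" where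
  "kappa G = Min {card (resolving_nbhd G x y) | x y. x \<in> verts G \<and> y \<in> verts G \<and> x \<noteq> y}"

text \<open>Only the values of \<open>g\<close> on the vertex set matter; elsewhere \<open>g\<close> is unconstrained.\<close>

definition resolving_function :: "('a, 'b) pre_digraph \<Rightarrow> real \<Rightarrow> ('a \<Rightarrow> real) \<Rightarrow> bool" where
  "resolving_function G k g \<longleftrightarrow>
     g \<in> verts G \<rightarrow> {0..1} \<and>
     (\<forall>x \<in> verts G. \<forall>y \<in> verts G. x \<noteq> y \<longrightarrow> k \<le> (\<Sum>s \<in> resolving_nbhd G x y. g s))"

text \<open>
  \<open>LEAST\<close> denotes the minimum of an infinite set of reals; it is attained whenever
  \<open>1 \<le> k \<le> kappa G\<close>, by compactness of the set of \<open>k\<close>-resolving functions.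
\<close>

definition frac_metric_dim_k :: "('a, 'b) pre_digraph \<Rightarrow> real \<Rightarrow> real" where
  "frac_metric_dim_k G k = (LEAST w. \<exists>g. resolving_function G k g \<and> w = (\<Sum>s \<in> verts G. g s))"

definition frac_metric_dim :: "('a, 'b) pre_digraph \<Rightarrow> real" where
  "frac_metric_dim G = frac_metric_dim_k G 1"

end

theory Submission
  imports Defs "HOL-Analysis.Function_Topology"
begin

text \<open>
  If \<open>g\<close> is \<open>k\<close>-resolving and \<open>k \<ge> 1\<close>, then \<open>g / k\<close> is \<open>1\<close>-resolving. Applying this to a
  \<open>k\<close>-resolving function of minimum weight gives the bound. Minima exist because the \<open>k\<close>-resolving
  functions vanishing off the vertex set form a compact set, nonempty for \<open>k \<le> kappa G\<close> since it
  contains the indicator of the vertex set.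
\<close>

lemma resolving_function_cong:
  assumes "\<And>s. s \<in> verts G \<Longrightarrow> g s = h s"
  shows "resolving_function G k g \<longleftrightarrow> resolving_function G k h"
proof -
  have "(\<Sum>s \<in> resolving_nbhd G x y. g s) = (\<Sum>s \<in> resolving_nbhd G x y. h s)" for x y
    by (rule sum.cong) (auto simp: assms resolving_nbhd_def)
  moreover have "g \<in> verts G \<rightarrow> {0..1} \<longleftrightarrow> h \<in> verts G \<rightarrow> {0..1}"
    by (simp add: Pi_iff assms)
  ultimately show ?thesis
    by (simp add: resolving_function_def)
qed

lemma resolving_function_const_1:
  assumes "finite (verts G)" and "k \<le> real (kappa G)"
  shows "resolving_function G k (\<lambda>_. 1)"
proof -
  have "kappa G \<le> card (resolving_nbhd G x y)"
    if "x \<in> verts G" "y \<in> verts G" "x \<noteq> y" for x y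
  proof -
    have "{card (resolving_nbhd G x y) | x y. x \<in> verts G \<and> y \<in> verts G \<and> x \<noteq> y}
        \<subseteq> (\<lambda>(x, y). card (resolving_nbhd G x y)) ` (verts G \<times> verts G)"
      by auto
    then have "finite {card (resolving_nbhd G x y) | x y. x \<in> verts G \<and> y \<in> verts G \<and> x \<noteq> y}"
      using assms(1) by (meson finite_SigmaI finite_imageI finite_subset)
    then show ?thesis
      unfolding kappa_def using that by (intro Min_le) blast+
  qed
  then show ?thesis
    using assms(2) by (fastforce simp: resolving_function_def)
qed

text \<open>Fixing the value 0 off the vertex set makes every coordinate range compact, so Tychonoff
  applies even if the vertex type is infinite; each pair of distinct vertices then cuts out a closed
  half-space.\<close>

lemma compact_resolving_functions:
  "compact {g. resolving_function G k g \<and> (\<forall>s. s \<notin> verts G \<longrightarrow> g s = 0)}" (is "compact ?C")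
proof -
  define B where "B = (\<Pi>\<^sub>E s\<in>UNIV. if s \<in> verts G then {0..1::real} else {0})"
  define P where "P = {(x, y). x \<in> verts G \<and> y \<in> verts G \<and> x \<noteq> y}"
  define D where "D = (\<lambda>(x, y). {g. k \<le> (\<Sum>s \<in> resolving_nbhd G x y. g s)})"
  have "compact B"
    \<comment> \<open>The topology on a function type is the product topology, so
      \<open>compactin_PiE\<close> reduces the claim to the single factors.\<close>
    unfolding compactin_euclidean_iff[symmetric] euclidean_product_topology[symmetric] B_def
    by (subst compactin_PiE) auto
  moreover have "closed (D p)" for p
    unfolding D_def
    by (cases p) (auto intro!: closed_Collect_le continuous_on_sum continuous_on_product_coordinates)
  ultimately have "compact (B \<inter> (\<Inter>p\<in>P. D p))"
    by (intro compact_Int_closed closed_INT) auto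
  also have "B \<inter> (\<Inter>p\<in>P. D p) = ?C"
    by (fastforce simp: B_def D_def P_def resolving_function_def PiE_iff split: if_splits)
  finally show ?thesis .
qed

text \<open>Makes the \<open>LEAST\<close> usable: over the reals it is informative only once the
  minimum is known to be attained.\<close>

lemma frac_metric_dim_k_minimum:
  assumes "finite (verts G)" and "k \<le> real (kappa G)"
  obtains g where "resolving_function G k g" "frac_metric_dim_k G k = (\<Sum>s \<in> verts G. g s)"
    and "\<And>h. resolving_function G k h \<Longrightarrow> frac_metric_dim_k G k \<le> (\<Sum>s \<in> verts G. h s)"
proof -
  define C where "C = {g. resolving_function G k g \<and> (\<forall>s. s \<notin> verts G \<longrightarrow> g s = 0)}"
  \<comment> \<open>Truncation preserves the weight on \<open>verts G\<close>, so a minimum over the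
    compact set \<open>C\<close> is a minimum over all \<open>k\<close>-resolving functions.\<close>
  have restrict: "(\<lambda>s. if s \<in> verts G then h s else 0) \<in> C" if "resolving_function G k h" for h
    using that resolving_function_cong[of G h "\<lambda>s. if s \<in> verts G then h s else 0" k]
    by (simp add: C_def)
  have "compact C"
    unfolding C_def by (rule compact_resolving_functions)
  moreover have "C \<noteq> {}"
    using restrict[OF resolving_function_const_1[OF assms]] by blast
  moreover have "continuous_on C (\<lambda>g. \<Sum>s \<in> verts G. g s)"
    by (intro continuous_on_sum continuous_on_subset[OF continuous_on_product_coordinates]) auto
  ultimately obtain g where "g \<in> C" and g: "\<And>h. h \<in> C \<Longrightarrow> (\<Sum>s \<in> verts G. g s) \<le> (\<Sum>s \<in> verts G. h s)"
    using continuous_attains_inf by metis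
  have res: "resolving_function G k g"
    using \<open>g \<in> C\<close> by (simp add: C_def)
  have min: "(\<Sum>s \<in> verts G. g s) \<le> (\<Sum>s \<in> verts G. h s)" if "resolving_function G k h" for h
    using g[OF restrict[OF that]] by simp
  have "frac_metric_dim_k G k = (\<Sum>s \<in> verts G. g s)"
    unfolding frac_metric_dim_k_def by (rule Least_equality) (use res min in auto)
  with res min show thesis
    by (intro that) auto
qed

text \<open>Division by \<open>k\<close> scales the threshold \<open>k\<close> to 1, and
  \<open>1 \<le> k\<close> keeps the values in the unit interval.\<close>

lemma resolving_function_divide:
  assumes "resolving_function G k g" and "1 \<le> k"
  shows "resolving_function G 1 (\<lambda>s. g s / k)"
  using assms
  by (auto simp: resolving_function_def Pi_iff sum_divide_distrib[symmetric] field_simps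
      intro: order_trans)

theorem lemma3p1:
  fixes G :: "('a, 'b) pre_digraph" and k :: real
  assumes "graph G"
    and "Digraph_Component.connected G"
    and "card (verts G) \<ge> 2"
    and "k \<in> {1..real (kappa G)}"
  shows "frac_metric_dim_k G k \<ge> k * frac_metric_dim G"
proof -
  \<comment> \<open>An infinite set has \<open>card\<close> 0, so the cardinality bound forces
    finiteness.\<close>
  have fin: "finite (verts G)"
    using assms(3) by (intro card_ge_0_finite) simp
  \<comment> \<open>The third bound ensures that the minimum at level 1 exists as well.\<close>
  have k: "1 \<le> k" "k \<le> real (kappa G)" "1 \<le> real (kappa G)"
    using assms(4) by auto
  obtain g where g: "resolving_function G k g" "frac_metric_dim_k G k = (\<Sum>s \<in> verts G. g s)"
    using frac_metric_dim_k_minimum[OF fin k(2)] by metis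
  have "frac_metric_dim G \<le> (\<Sum>s \<in> verts G. g s / k)"
    unfolding frac_metric_dim_def
    using frac_metric_dim_k_minimum[OF fin k(3)] resolving_function_divide[OF g(1) k(1)] by metis
  also have "\<dots> = frac_metric_dim_k G k / k"
    by (simp add: g(2) sum_divide_distrib)
  finally show ?thesis
    using k(1) by (simp add: field_simps)
qed

end
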